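(* For every positive integer $m$, there exists a shifted bicolored tableau $S$ of type B and shape $\mu=(m+2,m,m-1,m-2,\ldots,1)$, with $S\in\mathcal B^B(\mu,\lambda)$ for $\lambda=(m+2,m+1,m-1,m-2,\ldots,1)$, such that the repeated insertion process of type B of the variable index $2$ into $S$ with respect to $\lambda$ needs $2^m$ insertions.
   Context: **Partitions.** A strict partition is a strictly decreasing finite sequence $\lambda=(\lambda_1,\ldots,\lambda_\ell)$ of positive integers; $\ell(\lambda)=\ell$, $|\lambda|=\sum\lambda_i$, $\lambda_i=0$ for $i>\ell(\lambda)$. The type B shifted diagram is $[\lambda]=[\lambda]^B=\{(i,j): 1\le i\le \ell(\lambda),\ i\le j\le \lambda_i+i-1\}$ ($i$ = row, $j$ = column); diagonal cells are $(i,i)$. $\mu\subseteq\lambda$ means $[\mu]\subseteq[\lambda]$; $\nu$ covers $\mu$ if $\mu\subseteq\nu$ and $|\nu|-|\mu|=1$. **Bicolored tableaux.** A shifted bicolored tableau of type B and shape $\mu$ is a filling $T$ of $[\mu]$ by non-negative integers $T_{ij}$, each colored black or red, weakly increasing along rows and down columns (ignoring colors), with all diagonal entries black. $\mathcal B^B(\mu)$ is the set of all of them, and $\mathcal B^B(\mu,\lambda)$ the subset of those with $j\le\lambda_{i+T_{ij}}+i-1$ for all cells $(i,j)\in[\mu]$. The variable index represented by a black entry $T_{ij}$ is $i+T_{ij}$, by a red entry $j+T_{ij}$. **Bump of type B.** Input: a tableau $S$ of shape $\mu$, a cell $(i,j)\in[\mu]\cup\{(0,0)\}$, a direction $d\in\{\downarrow,\rightarrow\}$,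 an index $k\ge1$. Conventions: $S_{0,c}=0$ for all $c$; $S_{r,c}=\infty$ for positions $(r,c)\notin[\mu]$ with $1\le r\le c$; the position directly below a diagonal position counts as $\infty$, the position directly to the left of a diagonal position counts as $0$. If $d=\rightarrow$: set $j'=j+1$ and let $i'$, $1\le i'\le j'$, be the largest index with $S_{i'-1,j'}\le k-i'\le S_{i'+1,j'}$; $S'$ is $S$ with a black $k-i'$ written in position $(i',j')$ (replacing the old entry, if any). If $d=\downarrow$: set $i'=i+1$ and let $j'\ge i'$ be the largest index with $S_{i',j'-1}\le k-j'\le S_{i',j'+1}$; $S'$ is $S$ with a red $k-j'$ written in $(i',j')$, except that it is black if $i'=j'$. In both cases: if $(i',j')\notin[\mu]$, the new direction is $d'=\circ$ and $k'=\infty$ (stop). Otherwise, if the old entry $S_{i'j'}$ is black, then $d'=\rightarrow$ and $k'=S_{i'j'}+i'$; if it is red, then $d'=\downarrow$ and $k'=S_{i'j'}+j'$. **Insertion process of type B.** Given $S$ and an index $k$: perform the bump on $S$, $(0,0)$, $\downarrow$, $k$; then repeatedly perform the bump on the output $S',(i',j'),d',k'$ of the previous bump, until the direction is $\circ$; output the last tableau. The output is a shifted bicolored tableau of type B of some shape $\nu$ covering $\mu$. **Repeated insertion process of type B (with respect to $\lambda$).** Given $S\in\mathcal B^B(\mu,\lambda)$ and $k$: perform the insertion process with $S$ and $k$, obtaining $S'$ of shape $\nu$ covering $\mu$. If $\nu\subseteq\lambda$ and $S'\in\mathcal B^B(\nu,\lambda)$, stop and output $S'$. Otherwise let $k'$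 be the variable index represented by the entry of $S'$ in the unique cell of $[\nu]\setminus[\mu]$, remove that cell, and perform the insertion process with the resulting tableau of shape $\mu$ and $k'$; continue in the same manner until the result is in some $\mathcal B^B(\nu,\lambda)$ with $\nu\subseteq\lambda$ covering $\mu$. The number of insertions needed is the number of insertion processes performed. *)

theory Defs
  imports "HOL-Library.Extended_Nat"
begin

section \<open>Strict partitions and shifted diagrams\<close>

definition strict_partition :: "nat list \<Rightarrow> bool" where
  "strict_partition l \<longleftrightarrow> sorted_wrt (>) l \<and> (\<forall>x\<in>set l. 0 < x)"

text \<open>Parts are numbered from 1, and are 0 beyond the length; the value at index 0 is never used.\<close>

definition part :: "nat list \<Rightarrow> nat \<Rightarrow> nat" where
  "part l i = (if 1 \<le> i \<and> i \<le> length l then l ! (i - 1) else 0)"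

definition diagram :: "nat list \<Rightarrow> (nat \<times> nat) set" where
  "diagram l = {(i, j). 1 \<le> i \<and> i \<le> length l \<and> i \<le> j \<and> j \<le> part l i + i - 1}"

definition covers :: "nat list \<Rightarrow> nat list \<Rightarrow> bool" where
  "covers \<nu> \<mu> \<longleftrightarrow> diagram \<mu> \<subseteq> diagram \<nu> \<and> sum_list \<nu> = sum_list \<mu> + 1"


section \<open>Shifted bicolored tableaux of type B\<close>

datatype color = Black | Red

text \<open>A filling is a partial map on cells; its domain is the diagram of its shape.\<close>

type_synonym filling = "nat \<times> nat \<Rightarrow> (nat \<times> color) option"

definition value_at :: "filling \<Rightarrow> nat \<times> nat \<Rightarrow> nat" where
  "value_at T c = fst (the (T c))"

definition color_at :: "filling \<Rightarrow> nat \<times> nat \<Rightarrow> color" where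
  "color_at T c = snd (the (T c))"

definition bicolored_tableaux :: "nat list \<Rightarrow> filling set" where
  "bicolored_tableaux \<mu> = {T. dom T = diagram \<mu>
     \<and> (\<forall>i j. (i, j) \<in> diagram \<mu> \<and> (i, j + 1) \<in> diagram \<mu>
          \<longrightarrow> value_at T (i, j) \<le> value_at T (i, j + 1))
     \<and> (\<forall>i j. (i, j) \<in> diagram \<mu> \<and> (i + 1, j) \<in> diagram \<mu>
          \<longrightarrow> value_at T (i, j) \<le> value_at T (i + 1, j))
     \<and> (\<forall>i. (i, i) \<in> diagram \<mu> \<longrightarrow> color_at T (i, i) = Black)}"

definition bicolored_tableaux_within :: "nat list \<Rightarrow> nat list \<Rightarrow> filling set" where
  "bicolored_tableaux_within \<mu> \<Lambda> = {T \<in> bicolored_tableaux \<mu>.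
     \<forall>(i, j) \<in> diagram \<mu>. j \<le> part \<Lambda> (i + value_at T (i, j)) + i - 1}"

fun variable_index :: "nat \<times> nat \<Rightarrow> nat \<times> color \<Rightarrow> nat" where
  "variable_index (i, j) (t, Black) = i + t"
| "variable_index (i, j) (t, Red) = j + t"


section \<open>The bump of type B\<close>

definition entry :: "filling \<Rightarrow> nat \<Rightarrow> nat \<Rightarrow> enat" where
  "entry S i j = (case S (i, j) of None \<Rightarrow> \<infinity> | Some (t, _) \<Rightarrow> enat t)"

text \<open>The neighbours of a position \<open>(i, j)\<close> with \<open>1 \<le> i \<le> j\<close>. The position \<open>(i + 1, i)\<close> counts as
  infinity when seen from the diagonal cell above it, but as 0 when seen from the diagonal cell
  to its right, which is why there are four separate functions.\<close>

definition above :: "filling \<Rightarrow> nat \<Rightarrow> nat \<Rightarrow> enat" where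
  "above S i j = (if i = 1 then 0 else entry S (i - 1) j)"

definition below :: "filling \<Rightarrow> nat \<Rightarrow> nat \<Rightarrow> enat" where
  "below S i j = (if i = j then \<infinity> else entry S (i + 1) j)"

definition left_of :: "filling \<Rightarrow> nat \<Rightarrow> nat \<Rightarrow> enat" where
  "left_of S i j = (if i = j then 0 else entry S i (j - 1))"

definition right_of :: "filling \<Rightarrow> nat \<Rightarrow> nat \<Rightarrow> enat" where
  "right_of S i j = entry S i (j + 1)"

text \<open>As all entries are non-negative, the inequalities between neighbouring entries force
  \<open>k - i\<close> (respectively \<open>k - j\<close>) to be non-negative. This is made explicit by \<open>i \<le> k\<close>
  (respectively \<open>j \<le> k\<close>), because subtraction of natural numbers truncates.\<close>

definition fits_in_column :: "filling \<Rightarrow> nat \<Rightarrow> nat \<Rightarrow> nat \<Rightarrow> bool" where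
  "fits_in_column S j k i \<longleftrightarrow> 1 \<le> i \<and> i \<le> j \<and> i \<le> k
     \<and> above S i j \<le> enat (k - i) \<and> enat (k - i) \<le> below S i j"

definition fits_in_row :: "filling \<Rightarrow> nat \<Rightarrow> nat \<Rightarrow> nat \<Rightarrow> bool" where
  "fits_in_row S i k j \<longleftrightarrow> i \<le> j \<and> j \<le> k
     \<and> left_of S i j \<le> enat (k - j) \<and> enat (k - j) \<le> right_of S i j"

definition is_largest :: "(nat \<Rightarrow> bool) \<Rightarrow> nat \<Rightarrow> bool" where
  "is_largest P n \<longleftrightarrow> P n \<and> (\<forall>x. P x \<longrightarrow> x \<le> n)"

datatype direction = Downwards | Rightwards

text \<open>The new direction and the new variable index; \<open>None\<close> is the pair consisting of the
  stopping direction and the index infinity.\<close>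

definition bumped :: "filling \<Rightarrow> nat \<times> nat \<Rightarrow> (direction \<times> nat) option" where
  "bumped S c = (case S c of
       None \<Rightarrow> None
     | Some (t, Black) \<Rightarrow> Some (Rightwards, variable_index c (t, Black))
     | Some (t, Red) \<Rightarrow> Some (Downwards, variable_index c (t, Red)))"

text \<open>\<open>bump S c d k S' c' out\<close>: on input \<open>S, c, d, k\<close> the bump returns the tableau \<open>S'\<close>, the cell
  \<open>c'\<close>, and the new direction and index \<open>out\<close>.\<close>

inductive bump ::
  "filling \<Rightarrow> nat \<times> nat \<Rightarrow> direction \<Rightarrow> nat \<Rightarrow> filling \<Rightarrow> nat \<times> nat
     \<Rightarrow> (direction \<times> nat) option \<Rightarrow> bool"
where
  right: "\<lbrakk>j' = j + 1; is_largest (fits_in_column S j' k) i'\<rbrakk>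
    \<Longrightarrow> bump S (i, j) Rightwards k (S((i', j') \<mapsto> (k - i', Black))) (i', j') (bumped S (i', j'))"
| down: "\<lbrakk>i' = i + 1; is_largest (fits_in_row S i' k) j'\<rbrakk>
    \<Longrightarrow> bump S (i, j) Downwards k
          (S((i', j') \<mapsto> (k - j', if i' = j' then Black else Red))) (i', j') (bumped S (i', j'))"


section \<open>Insertion and repeated insertion\<close>

inductive bump_chain :: "filling \<Rightarrow> nat \<times> nat \<Rightarrow> direction \<Rightarrow> nat \<Rightarrow> filling \<Rightarrow> bool" where
  stop: "bump S c d k S' c' None \<Longrightarrow> bump_chain S c d k S'"
| continue: "\<lbrakk>bump S c d k S' c' (Some (d', k')); bump_chain S' c' d' k' S''\<rbrakk>
    \<Longrightarrow> bump_chain S c d k S''"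

definition insertion :: "filling \<Rightarrow> nat \<Rightarrow> filling \<Rightarrow> bool" where
  "insertion S k S' \<longleftrightarrow> bump_chain S (0, 0) Downwards k S'"

text \<open>\<open>repeated_insertion \<mu> \<Lambda> S k n S'\<close>: the repeated insertion of \<open>k\<close> into the tableau \<open>S\<close> of
  shape \<open>\<mu>\<close> with respect to \<open>\<Lambda>\<close> terminates with output \<open>S'\<close> after exactly \<open>n\<close> insertion
  processes.\<close>

inductive repeated_insertion ::
  "nat list \<Rightarrow> nat list \<Rightarrow> filling \<Rightarrow> nat \<Rightarrow> nat \<Rightarrow> filling \<Rightarrow> bool"
  for \<mu> \<Lambda> :: "nat list"
where
  finish: "\<lbrakk>insertion S k S'; strict_partition \<nu>; dom S' = diagram \<nu>; covers \<nu> \<mu>;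
      diagram \<nu> \<subseteq> diagram \<Lambda>; S' \<in> bicolored_tableaux_within \<nu> \<Lambda>\<rbrakk>
    \<Longrightarrow> repeated_insertion \<mu> \<Lambda> S k 1 S'"
| again: "\<lbrakk>insertion S k S'; strict_partition \<nu>; dom S' = diagram \<nu>; covers \<nu> \<mu>;
      \<not> (diagram \<nu> \<subseteq> diagram \<Lambda> \<and> S' \<in> bicolored_tableaux_within \<nu> \<Lambda>);
      diagram \<nu> - diagram \<mu> = {c}; S' c = Some e;
      repeated_insertion \<mu> \<Lambda> (S'(c := None)) (variable_index c e) n S''\<rbrakk>
    \<Longrightarrow> repeated_insertion \<mu> \<Lambda> S k (Suc n) S''"


text \<open>All these relations are deterministic, so the number of insertions and the output are
  determined by the input.\<close>

lemma is_largest_unique: "is_largest P m \<Longrightarrow> is_largest P n \<Longrightarrow> m = n"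
  unfolding is_largest_def by (meson le_antisym)

lemma bump_unique:
  "bump S c d k S1 c1 o1 \<Longrightarrow> bump S c d k S2 c2 o2 \<Longrightarrow> S1 = S2 \<and> c1 = c2 \<and> o1 = o2"
  by (auto elim!: bump.cases dest: is_largest_unique)

lemma bump_chain_unique:
  "bump_chain S c d k S1 \<Longrightarrow> bump_chain S c d k S2 \<Longrightarrow> S1 = S2"
proof (induction arbitrary: S2 rule: bump_chain.induct)
  case (stop S c d k S' c')
  from stop.prems show ?case
    by cases (use stop.hyps bump_unique in blast)+
next
  case (continue S c d k S' c' d' k' S'')
  from continue.prems show ?case
  proof cases
    case stop
    then show ?thesis using continue.hyps(1) bump_unique by blast
  next
    case (continue T a b l)
    then have "S' = T" "c' = a" "(d', k') = (b, l)"
      using \<open>bump S c d k S' c' (Some (d', k'))\<close> bump_unique by blast+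
    then show ?thesis using continue.IH continue by blast
  qed
qed

lemma insertion_unique: "insertion S k S1 \<Longrightarrow> insertion S k S2 \<Longrightarrow> S1 = S2"
  unfolding insertion_def by (rule bump_chain_unique)

lemma diagram_row:
  assumes "strict_partition l"
  shows "card {j. (i, j) \<in> diagram l} = part l i"
proof (cases "1 \<le> i \<and> i \<le> length l")
  case True
  then have "part l i > 0"
    using assms by (auto simp: part_def strict_partition_def)
  then have "{j. (i, j) \<in> diagram l} = {i..<i + part l i}"
    using True by (auto simp: diagram_def)
  then show ?thesis by simp
qed (auto simp: diagram_def part_def)

lemma diagram_inject:
  assumes "strict_partition l" "strict_partition l'" "diagram l = diagram l'"
  shows "l = l'"
proof -
  have p: "part l i = part l' i" for i
    using diagram_row assms by metis
  have "part a (Suc i) > 0 \<longleftrightarrow> i < length a" if "strict_partition a" for a i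
    using that by (auto simp: part_def strict_partition_def)
  then have "i < length l \<longleftrightarrow> i < length l'" for i
    using assms p by metis
  then have "length l = length l'"
    by (meson linorder_neqE_nat less_irrefl)
  moreover have "l ! i = l' ! i" if "i < length l" for i
    using p[of "Suc i"] that \<open>length l = length l'\<close> by (simp add: part_def)
  ultimately show ?thesis by (simp add: nth_equalityI)
qed

lemma repeated_insertion_unique:
  "repeated_insertion \<mu> \<Lambda> S k n1 S1 \<Longrightarrow> repeated_insertion \<mu> \<Lambda> S k n2 S2
    \<Longrightarrow> n1 = n2 \<and> S1 = S2"
proof (induction arbitrary: n2 S2 rule: repeated_insertion.induct)
  case (finish S k S' \<nu>)
  note hyp = finish.hyps
  from finish.prems show ?case
  proof cases
    case (finish)
    then show ?thesis using hyp(1) insertion_unique by blast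
  next
    case (again T \<nu>')
    then have "S' = T" using hyp(1) insertion_unique by blast
    then have "\<nu> = \<nu>'" using again hyp diagram_inject by metis
    then show ?thesis using again hyp \<open>S' = T\<close> by blast
  qed
next
  case (again S k S' \<nu> c e n S'')
  note hyp = again.hyps and IH = again.IH
  from again.prems show ?case
  proof cases
    case (finish \<nu>')
    then have "S' = S2" using hyp(1) insertion_unique by blast
    then have "\<nu> = \<nu>'" using finish hyp diagram_inject by metis
    then show ?thesis using finish hyp \<open>S' = S2\<close> by blast
  next
    case (again T \<nu>' c' e' n')
    then have T: "S' = T" using hyp(1) insertion_unique by blast
    then have "\<nu> = \<nu>'" using again hyp diagram_inject by metis
    then have "c = c'" using again hyp by simp
    moreover have "e = e'" using again hyp T \<open>c = c'\<close> by simp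
    ultimately show ?thesis using again IH T by blast
  qed
qed

end

theory Submission
  imports Defs
begin

text \<open>
  The condition with respect to \<open>\<Lambda>\<close> forces all entries of \<open>S\<close> to be 0, so only the colors can be
  chosen: the off-diagonal cells of row 2 are red, all other cells are black. During the process
  all values remain 0, except in a cell added outside \<open>\<mu>\<close>, and a bump is a switch: a path that
  enters a cell downwards (rightwards) leaves it downwards if it was red and rightwards if it was
  black, and colors it red (black). Two consecutive insertions amount to one path through the
  staircase of rows \<open>2, \<dots>, m + 1\<close>; it leaves the staircase at the right end of some row \<open>l\<close>. If
  \<open>l = 2\<close>, the process ends, and otherwise the next path enters at the top of column \<open>l\<close>.

  Column \<open>l\<close> above the diagonal and row \<open>l\<close> right of it form \<open>line l\<close>, and lines \<open>i < j\<close> cross exactly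
  once, in the cell \<open>(i, j)\<close>. Lines 3 and higher act as a binary counter: if a path is about to
  cross on line 3 a line \<open>j\<close> whose crossings with \<open>3, \<dots>, j - 1\<close> are black except for the red
  \<open>(3, j)\<close>, then the ends of lines are reached \<open>2 ^ (j - 3) - 2\<close> times before line \<open>j\<close> is followed
  to the right of its diagonal. Row 2 triggers this for \<open>j = 3, \<dots>, m + 1\<close>, which gives \<open>2 ^ (m - 1)\<close>
  paths.
\<close>

section \<open>Lines and crossings\<close>

text \<open>\<open>walk n R l p N\<close>: if \<open>R\<close> is the set of red crossings and the path is about to cross line \<open>p\<close> on
  line \<open>l\<close>, then it comes to the end of line 2 and this is the \<open>N\<close>-th time that an end of a line is
  reached. The position \<open>p = l\<close> is the diagonal cell, and \<open>p = n + 1\<close> is the end of the line.\<close>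

inductive walk :: "nat \<Rightarrow> (nat \<times> nat) set \<Rightarrow> nat \<Rightarrow> nat \<Rightarrow> nat \<Rightarrow> bool" for n where
  final: "walk n R 2 (Suc n) 1"
| new_pass: "\<lbrakk>walk n R l 2 N; 3 \<le> l; l \<le> n\<rbrakk> \<Longrightarrow> walk n R l (Suc n) (Suc N)"
| turn: "\<lbrakk>walk n R l (Suc l) N; 2 \<le> l; l \<le> n\<rbrakk> \<Longrightarrow> walk n R l l N"
| down_red: "\<lbrakk>walk n R l (Suc p) N; 2 \<le> p; p < l; l \<le> n; (p, l) \<in> R\<rbrakk> \<Longrightarrow> walk n R l p N"
| down_black: "\<lbrakk>walk n (insert (p, l) R) p (Suc l) N; 2 \<le> p; p < l; l \<le> n; (p, l) \<notin> R\<rbrakk>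
    \<Longrightarrow> walk n R l p N"
| right_black: "\<lbrakk>walk n R l (Suc p) N; 2 \<le> l; l < p; p \<le> n; (l, p) \<notin> R\<rbrakk> \<Longrightarrow> walk n R l p N"
| right_red: "\<lbrakk>walk n (R - {(l, p)}) p (Suc l) N; 2 \<le> l; l < p; p \<le> n; (l, p) \<in> R\<rbrakk>
    \<Longrightarrow> walk n R l p N"

lemma walk_right_red_insert:
  assumes "walk n R p (Suc l) N" "2 \<le> l" "l < p" "p \<le> n" "(l, p) \<notin> R"
  shows "walk n (insert (l, p) R) l p N"
  by (rule walk.right_red) (use assms in simp_all)

lemma walk_right:
  assumes "walk n R l p' N" "p \<le> p'" and "2 \<le> l" "l < p" "p' \<le> Suc n"
    and "\<And>q. p \<le> q \<Longrightarrow> q < p' \<Longrightarrow> (l, q) \<notin> R"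
  shows "walk n R l p N"
  using assms(2,1,3-)
proof (induction p rule: inc_induct)
  case base
  then show ?case by simp
next
  case (step p)
  have "walk n R l (Suc p) N"
    using step.prems by (intro step.IH) auto
  then show ?case
    by (rule walk.right_black) (use step.hyps step.prems in auto)
qed

text \<open>\<open>N\<close> counts the ends still ahead, so derivations of \<open>walk\<close> grow
  against the direction of the path.\<close>

lemma walk_pass:
  assumes "walk n R l 2 N"
    and "3 \<le> l" "l < p" "p \<le> Suc n" "\<And>q. p \<le> q \<Longrightarrow> q \<le> n \<Longrightarrow> (l, q) \<notin> R"
  shows "walk n R l p (Suc N)"
proof (rule walk_right)
  show "walk n R l (Suc n) (Suc N)"
    using assms by (intro walk.new_pass) auto
qed (use assms in auto)

lemma walk_turn3:
  assumes "walk n (insert (3, j) R) 3 4 N"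
    and "4 \<le> j" "j \<le> n" "(2, 3) \<in> R" "\<And>q. j \<le> q \<Longrightarrow> q \<le> n \<Longrightarrow> (3, q) \<notin> R"
  shows "walk n R j 3 (Suc N)"
proof -
  have "walk n (insert (3, j) R) 3 (Suc 2) N"
    using walk.turn[of n _ 3 N] assms by simp
  then have "walk n (insert (3, j) R) 3 2 N"
    by (rule walk.down_red) (use assms in simp_all)
  then have "walk n (insert (3, j) R) 3 (Suc j) (Suc N)"
    by (rule walk_pass) (use assms in auto)
  then show ?thesis
    by (rule walk.down_black) (use assms in auto)
qed

text \<open>Supplies \<open>N + 2 ^ b - 2 ^ a\<close> without truncated subtraction.\<close>

lemma power_of_two_cancel: "a \<le> b \<Longrightarrow> \<exists>M. M + 2 ^ a = N + (2::nat) ^ b"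
  by (metis le_add2 le_add_diff_inverse2 le_trans one_le_numeral power_increasing)

text \<open>The counter. For \<open>i = 3\<close> the path needs \<open>2 ^ (j - 3) - 2\<close> passes to return to line \<open>j\<close>; the
  induction passes from red \<open>(i, j)\<close> to red \<open>(i + 1, j)\<close>, between which line \<open>i + 1\<close> runs its own
  counter on the lines below it. The last assumption is
  \<open>M = N + 2 ^ (j - 3) - 2 ^ (i - 2)\<close> without subtraction.\<close>

lemma walk_nested:
  assumes "walk n R j (Suc j) N" and "3 \<le> i" "i < j" "j \<le> n"
    and "\<And>q. 3 \<le> q \<Longrightarrow> q < j \<Longrightarrow> (2, q) \<in> R"
    and "\<And>p q. 3 \<le> p \<Longrightarrow> p < j \<Longrightarrow> p < q \<Longrightarrow> q \<le> n \<Longrightarrow> (p, q) \<notin> R"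
    and "M + 2 ^ (i - 2) = N + 2 ^ (j - 3)"
  shows "walk n (insert (i, j) R) i (Suc i) M"
  using assms
proof (induction j arbitrary: i R N M rule: less_induct)
  case (less j)
  note j_walk = less.prems(1) and red = less.prems(5) and black = less.prems(6)
  have nested: "walk n (insert (i, j) R) i (Suc i) M"
    if "i \<le> j - 1" "3 \<le> i" "M + 2 ^ (i - 2) = N + 2 ^ (j - 3)" for i M
    using that
  proof (induction i arbitrary: M rule: inc_induct)
    case base
    define i where "i = j - 1"
    have i: "Suc i = j" "3 \<le> i" using base less.prems(3) unfolding i_def by auto
    have "j - 1 - 2 = j - 3" by simp
    then have "M = N" using base(2) by simp
    then have "walk n R j (Suc i) M"
      unfolding i using j_walk walk.turn less.prems by auto
    then have "walk n (insert (i, j) R) i j M"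
      by (rule walk_right_red_insert) (use i black less.prems in auto)
    then show ?case unfolding i_def[symmetric] i .
  next
    case (step i)
    define R' where "R' = insert (Suc i, j) R"
    have ij: "Suc i < j" "3 \<le> i" "j \<le> n" using step.hyps step.prems less.prems(4) by auto
    obtain M1 where M1: "M1 + 2 ^ (i - 1) = N + 2 ^ (j - 3)"
      using power_of_two_cancel[of "i - 1" "j - 3" N] ij by fastforce
    have i3: "Suc i - 3 = i - 2" "1 \<le> i - 2" using ij by auto
    obtain M2 where M2: "M2 + 2 ^ (3 - 2) = M1 + 2 ^ (Suc i - 3)"
      using power_of_two_cancel[OF i3(2), of M1] i3(1) by auto
    have "(2::nat) ^ (i - 1) = 2 * 2 ^ (i - 2)"
      using ij by (simp flip: power_Suc add: Suc_diff_le)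
    then have M: "M = Suc (Suc M2)"
      using M1 M2 i3 step.prems by simp
    have "walk n R' (Suc i) (Suc (Suc i)) M1"
      unfolding R'_def by (rule step.IH) (use ij M1 in auto)
    then have "walk n (insert (3, Suc i) R') 3 (Suc 3) M2"
      by (intro less.IH[of "Suc i" _ M1 3]) (use ij M2 red black in \<open>auto simp: R'_def\<close>)
    then have "walk n R' (Suc i) (Suc 2) (Suc M2)"
      by (simp, intro walk_turn3) (use ij red black in \<open>auto simp: R'_def\<close>)
    then have "walk n R' (Suc i) 2 (Suc M2)"
      by (rule walk.down_red) (use ij red in \<open>simp_all add: R'_def\<close>)
    then have "walk n R' (Suc i) (Suc j) M"
      unfolding M by (rule walk_pass) (use ij black in \<open>auto simp: R'_def\<close>)
    then have "walk n R j (Suc i) M"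
      unfolding R'_def by (rule walk.down_black) (use ij black in auto)
    then have "walk n (insert (i, j) R) i j M"
      by (rule walk_right_red_insert) (use ij black in auto)
    then show ?case
      by (rule walk_right) (use ij black in auto)
  qed
  show ?case using less.prems by (intro nested) auto
qed

lemma walk_second_row:
  assumes "3 \<le> j" "j \<le> n" and "N + 2 ^ (j - 2) = Suc (2 ^ (n - 2))"
  shows "walk n ({2} \<times> {3..n} - {(2, j)}) j 2 N"
  using assms(2,1,3)
proof (induction j arbitrary: N rule: inc_induct)
  case base
  then have "N = 1" by simp
  then have "walk n (insert (2, n) ({2} \<times> {3..n} - {(2, n)})) 2 (Suc n) N"
    using walk.final by metis
  then show ?case
    by (rule walk.down_black) (use base in auto)
next
  case (step j)
  define R where "R = {2::nat} \<times> {3..n}"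
  have j: "3 \<le> j" "j < n" using step by auto
  have pow: "(2::nat) ^ (Suc j - 2) = 2 * 2 ^ (j - 2)"
    using j by (simp flip: power_Suc add: Suc_diff_le)
  have j3: "Suc j - 3 = j - 2" "1 \<le> j - 2" using j by auto
  obtain M :: nat where M: "M + 2 ^ (Suc j - 2) = 1 + 2 ^ (n - 2)"
    using power_of_two_cancel[of "Suc j - 2" "n - 2" 1] j by fastforce
  obtain M2 where M2: "M2 + 2 ^ (3 - 2) = Suc M + 2 ^ (Suc j - 3)"
    using power_of_two_cancel[OF j3(2), of "Suc M"] j3(1) by auto
  have N: "N = Suc M2"
    using M M2 pow step.prems j3 by simp
  have "walk n (R - {(2, Suc j)}) (Suc j) 2 M"
    unfolding R_def by (rule step.IH) (use j M in auto)
  then have "walk n (R - {(2, Suc j)}) (Suc j) (Suc (Suc j)) (Suc M)"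
    by (rule walk_pass) (use j in \<open>auto simp: R_def\<close>)
  then have "walk n (insert (3, Suc j) (R - {(2, Suc j)})) 3 (Suc 3) M2"
    by (rule walk_nested) (use j M2 in \<open>auto simp: R_def\<close>)
  then have "walk n (R - {(2, Suc j)}) (Suc j) (Suc 2) N"
    unfolding N by (simp, intro walk_turn3) (use j in \<open>auto simp: R_def\<close>)
  then have "walk n R 2 (Suc j) N"
    by (rule walk.right_red) (use j in \<open>auto simp: R_def\<close>)
  moreover have "insert (2, j) (R - {(2, j)}) = R"
    using j by (auto simp: R_def)
  ultimately have "walk n (insert (2, j) (R - {(2, j)})) 2 (Suc j) N"
    by simp
  then show ?case
    unfolding R_def by (rule walk.down_black) (use j in auto)
qed

lemma walk_total:
  assumes "2 \<le> n"
  shows "walk n ({2} \<times> {3..n}) 2 2 (2 ^ (n - 2))"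
proof (rule walk.turn)
  define R where "R = {2::nat} \<times> {3..n}"
  have "walk n R 2 (Suc 2) (2 ^ (n - 2))"
  proof (cases "n = 2")
    case True
    then show ?thesis using walk.final[of 2 R] by simp
  next
    case False
    have "(2::nat) ^ 1 \<le> 2 ^ (n - 2)"
      using assms False by (intro power_increasing) auto
    then obtain N where N: "2 ^ (n - 2) = Suc N" and "1 \<le> N"
      by (cases "2 ^ (n - 2) :: nat") auto
    \<comment> \<open>The first path makes \<open>(2, 3)\<close> black and turns at
      \<open>(3, 3)\<close> at once, so it costs one pass and starts no counter.\<close>
    have "walk n (R - {(2, 3)}) 3 2 N"
      unfolding R_def by (rule walk_second_row) (use assms False N in auto)
    then have "walk n (R - {(2, 3)}) 3 (Suc 3) (Suc N)"
      by (rule walk_pass) (use assms False in \<open>auto simp: R_def\<close>)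
    then have "walk n (R - {(2, 3)}) 3 (Suc 2) (Suc N)"
      using walk.turn[of n _ 3] assms False by simp
    then show ?thesis
      unfolding N using walk.right_red[of n R 2 3 "Suc N"] assms False by (simp add: R_def)
  qed
  then show "walk n ({2} \<times> {3..n}) 2 (Suc 2) (2 ^ (n - 2))"
    by (simp add: R_def)
qed (use assms in auto)

section \<open>Tableaux with zero entries\<close>

definition zeros :: "(nat \<times> nat) set \<Rightarrow> (nat \<times> nat) set \<Rightarrow> filling" where
  "zeros D R = (\<lambda>c. if c \<in> D then Some (0, if c \<in> R then Red else Black) else None)"

definition cells :: "nat \<Rightarrow> (nat \<times> nat) set" where
  "cells n = {(i, j). 1 \<le> i \<and> i \<le> n \<and> i \<le> j \<and> j \<le> (if i = 1 then Suc n else n)}"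

lemma dom_zeros [simp]: "dom (zeros D R) = D"
  by (auto simp: zeros_def split: if_splits)

lemma zeros_update_red: "c \<in> D \<Longrightarrow> (zeros D R)(c \<mapsto> (0, Red)) = zeros D (insert c R)"
  by (auto simp: zeros_def)

lemma zeros_update_black: "c \<in> D \<Longrightarrow> (zeros D R)(c \<mapsto> (0, Black)) = zeros D (R - {c})"
  by (auto simp: zeros_def)

lemma entry_zeros: "entry (zeros D R) i j = (if (i, j) \<in> D then 0 else \<infinity>)"
  by (simp add: entry_def zeros_def zero_enat_def)

lemma bumped_zeros:
  "bumped (zeros D R) (i, j) =
    (if (i, j) \<notin> D then None else if (i, j) \<in> R then Some (Downwards, j) else Some (Rightwards, i))"
  by (simp add: bumped_def zeros_def)

text \<open>For an entry 0 the bound just says that its cell lies in the diagram of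
  \<open>\<Lambda>\<close>.\<close>

lemma zeros_within:
  assumes "\<And>i. (i, i) \<notin> R" "diagram \<nu> \<subseteq> diagram \<Lambda>"
  shows "zeros (diagram \<nu>) R \<in> bicolored_tableaux_within \<nu> \<Lambda>"
  using assms
  by (auto simp: bicolored_tableaux_within_def bicolored_tableaux_def value_at_def color_at_def
      zeros_def diagram_def dom_def)

text \<open>Among zeros the index \<open>j\<close> fits in its own column with value 0, and no later
  column is allowed. So a downward index is always the column, and a rightward one the row.\<close>

lemma bump_down:
  assumes "(Suc i, j) \<in> cells n" "(Suc i, Suc i) \<notin> R"
  shows "bump (zeros (cells n) R) (i, i') Downwards j
    (zeros (cells n) (if Suc i = j then R else insert (Suc i, j) R)) (Suc i, j)
    (Some (if (Suc i, j) \<in> R then (Downwards, j) else (Rightwards, Suc i)))"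
proof -
  let ?S = "zeros (cells n) R"
  have "is_largest (fits_in_row ?S (Suc i) j) j"
    using assms(1)
    by (auto simp: is_largest_def fits_in_row_def left_of_def right_of_def entry_zeros cells_def
        zero_enat_def)
  then have "bump ?S (i, i') Downwards j
      (?S((Suc i, j) \<mapsto> (j - j, if Suc i = j then Black else Red))) (Suc i, j)
      (bumped ?S (Suc i, j))"
    by (intro bump.down) simp_all
  moreover have "?S((Suc i, j) \<mapsto> (j - j, if Suc i = j then Black else Red)) =
      zeros (cells n) (if Suc i = j then R else insert (Suc i, j) R)"
    using assms by (auto simp: zeros_update_red zeros_update_black)
  moreover have "bumped ?S (Suc i, j) =
      Some (if (Suc i, j) \<in> R then (Downwards, j) else (Rightwards, Suc i))"
    using assms by (auto simp: bumped_zeros)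
  ultimately show ?thesis by simp
qed

lemma bump_right:
  assumes "(i, Suc j) \<in> cells n"
  shows "bump (zeros (cells n) R) (i', j) Rightwards i
    (zeros (cells n) (R - {(i, Suc j)})) (i, Suc j)
    (Some (if (i, Suc j) \<in> R then (Downwards, Suc j) else (Rightwards, i)))"
proof -
  let ?S = "zeros (cells n) R"
  have "is_largest (fits_in_column ?S (Suc j) i) i"
    using assms
    by (auto simp: is_largest_def fits_in_column_def above_def below_def entry_zeros cells_def
        zero_enat_def split: if_splits)
  then have "bump ?S (i', j) Rightwards i (?S((i, Suc j) \<mapsto> (i - i, Black))) (i, Suc j)
      (bumped ?S (i, Suc j))"
    by (intro bump.right) simp_all
  then show ?thesis
    using assms by (simp add: zeros_update_black bumped_zeros split: if_splits)
qed

text \<open>Column \<open>n + 1\<close> has a cell in row 1 only, so rows from 3 on have infinity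
  above them; row 2 fits and stores \<open>l\<close> as \<open>l - 2\<close>.\<close>

lemma bump_exit:
  assumes "2 \<le> n" "2 \<le> l"
  shows "bump (zeros (cells n) R) (i', n) Rightwards l
    ((zeros (cells n) R)((2, Suc n) \<mapsto> (l - 2, Black))) (2, Suc n) None"
proof -
  let ?S = "zeros (cells n) R"
  have "above ?S i (Suc n) = \<infinity>" if "3 \<le> i" for i
    using that by (auto simp: above_def entry_zeros cells_def)
  then have "i \<le> 2" if "fits_in_column ?S (Suc n) l i" for i
    using that not_less_eq_eq[of i 2] by (auto simp: fits_in_column_def)
  moreover have "fits_in_column ?S (Suc n) l 2"
    using assms
    by (auto simp: fits_in_column_def above_def below_def entry_zeros cells_def zero_enat_def)
  ultimately have "is_largest (fits_in_column ?S (Suc n) l) 2"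
    by (auto simp: is_largest_def)
  moreover have "bumped ?S (2, Suc n) = None"
    using assms by (auto simp: bumped_zeros cells_def)
  ultimately show ?thesis
    using bump.right[of "Suc n" n ?S l 2 i'] by simp
qed

lemma bump_exit_first:
  "bump (zeros (cells n) R) (i', Suc n) Rightwards 1
    ((zeros (cells n) R)((1, Suc (Suc n)) \<mapsto> (0, Black))) (1, Suc (Suc n)) None"
proof -
  let ?S = "zeros (cells n) R"
  have "is_largest (fits_in_column ?S (Suc (Suc n)) 1) 1"
    by (auto simp: is_largest_def fits_in_column_def above_def below_def entry_zeros cells_def)
  moreover have "bumped ?S (1, Suc (Suc n)) = None"
    by (auto simp: bumped_zeros cells_def)
  ultimately show ?thesis
    using bump.right[of "Suc (Suc n)" "Suc n" ?S 1 1 i'] by simp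
qed

section \<open>From walks to repeated insertions\<close>

locale staircase =
  fixes n :: nat and \<mu> \<Lambda> :: "nat list"
  assumes n: "2 \<le> n"
    and \<mu>: "\<mu> = Suc n # rev [1..<n]"
    and \<Lambda>: "\<Lambda> = Suc n # n # rev [1..<n - 1]"
begin

text \<open>The shape reached when row 1 grows; it is not contained in
  \<open>\<Lambda>\<close>.\<close>

definition \<mu>' :: "nat list" where "\<mu>' = Suc (Suc n) # rev [1..<n]"

lemma diagram_eqs:
  "diagram \<mu> = cells n"
  "diagram \<Lambda> = insert (2, Suc n) (cells n)"
  "diagram \<mu>' = insert (1, Suc (Suc n)) (cells n)"
  using n
  by (auto simp: diagram_def part_def cells_def \<mu> \<Lambda> \<mu>'_def nth_Cons rev_nth split: nat.splits if_splits)

lemma strict_partitions: "strict_partition \<Lambda>" "strict_partition \<mu>'"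
  using n by (auto simp: strict_partition_def \<Lambda> \<mu>'_def sorted_wrt_rev)

lemma part_\<Lambda>: "3 \<le> i \<Longrightarrow> i \<le> n \<Longrightarrow> part \<Lambda> i = Suc n - i"
  by (auto simp: part_def \<Lambda> nth_Cons rev_nth split: nat.splits)

lemma covers: "covers \<Lambda> \<mu>" "covers \<mu>' \<mu>"
proof -
  have "sum_list (rev [1..<n]) = n - 1 + sum_list (rev [1..<n - 1])"
    using n by (cases n) (auto simp: upt_Suc)
  then show "covers \<Lambda> \<mu>" "covers \<mu>' \<mu>"
    using n by (auto simp: covers_def diagram_eqs) (auto simp: \<mu> \<Lambda> \<mu>'_def)
qed

text \<open>The insertion whose next bump is given by \<open>S, c, d, k\<close> is the first of \<open>N\<close> insertions, whatever
  tableau it was started from.\<close>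

definition completes :: "filling \<Rightarrow> nat \<times> nat \<Rightarrow> direction \<Rightarrow> nat \<Rightarrow> nat \<Rightarrow> bool" where
  "completes S c d k N \<longleftrightarrow> (\<exists>S'. bump_chain S c d k S' \<and>
     (\<forall>S0 k0. insertion S0 k0 S' \<longrightarrow> (\<exists>T. repeated_insertion \<mu> \<Lambda> S0 k0 N T)))"

lemma completes_continue:
  "completes S' c' d' k' N \<Longrightarrow> bump S c d k S' c' (Some (d', k')) \<Longrightarrow> completes S c d k N"
  unfolding completes_def by (blast intro: bump_chain.continue)

lemma completes_insertion:
  "completes S (0, 0) Downwards k N \<Longrightarrow> \<exists>T. repeated_insertion \<mu> \<Lambda> S k N T"
  unfolding completes_def insertion_def by blast

lemma completes_right:
  assumes "completes (zeros (cells n) R) (i, j') Rightwards i N"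
    and "j \<le> j'" and "1 \<le> i" "i \<le> j" "(i, j') \<in> cells n"
    and "\<And>q. j < q \<Longrightarrow> q \<le> j' \<Longrightarrow> (i, q) \<notin> R"
  shows "completes (zeros (cells n) R) (i, j) Rightwards i N"
  using assms(2,1,3-)
proof (induction j rule: inc_induct)
  case base
  then show ?case by simp
next
  case (step j)
  have "completes (zeros (cells n) R) (i, Suc j) Rightwards i N"
    using step.prems by (intro step.IH) auto
  moreover have "(i, Suc j) \<in> cells n" "(i, Suc j) \<notin> R"
    using step.hyps step.prems by (auto simp: cells_def)
  ultimately show ?case
    using bump_right[of i j n R i] by (auto intro: completes_continue)
qed

lemma completes_exit_first:
  assumes "repeated_insertion \<mu> \<Lambda> (zeros (cells n) R) 1 N T"
  shows "completes (zeros (cells n) R) (1, Suc n) Rightwards 1 (Suc N)"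
proof -
  let ?c = "(1, Suc (Suc n))" and ?S = "zeros (cells n) R"
  define S' where "S' = ?S(?c \<mapsto> (0, Black))"
  have c: "?c \<notin> cells n" "?c \<notin> diagram \<Lambda>"
    by (auto simp: cells_def diagram_eqs)
  have "\<exists>T. repeated_insertion \<mu> \<Lambda> S0 k0 (Suc N) T" if "insertion S0 k0 S'" for S0 k0
  proof (intro exI repeated_insertion.again[where \<nu> = \<mu>' and c = ?c and e = "(0, Black)"])
    show "dom S' = diagram \<mu>'" "S' ?c = Some (0, Black)"
      by (auto simp: S'_def diagram_eqs)
    show "\<not> (diagram \<mu>' \<subseteq> diagram \<Lambda> \<and> S' \<in> bicolored_tableaux_within \<mu>' \<Lambda>)"
      using c by (auto simp: diagram_eqs)
    show "diagram \<mu>' - diagram \<mu> = {?c}"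
      using c by (auto simp: diagram_eqs)
    have "S'(?c := None) = ?S"
      using c by (auto simp: S'_def zeros_def)
    then show "repeated_insertion \<mu> \<Lambda> (S'(?c := None)) (variable_index ?c (0, Black)) N T"
      using assms by simp
  qed (use that strict_partitions covers in auto)
  moreover have "bump_chain ?S (1, Suc n) Rightwards 1 S'"
    unfolding S'_def by (rule bump_chain.stop) (rule bump_exit_first)
  ultimately show ?thesis
    unfolding completes_def by blast
qed

lemma completes_exit:
  assumes "repeated_insertion \<mu> \<Lambda> (zeros (cells n) R) l N T" "3 \<le> l" "l \<le> n"
  shows "completes (zeros (cells n) R) (l, n) Rightwards l (Suc N)"
proof -
  let ?c = "(2, Suc n)" and ?S = "zeros (cells n) R" and ?e = "(l - 2, Black)"
  define S' where "S' = ?S(?c \<mapsto> ?e)"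
  have c: "?c \<notin> cells n" "?c \<in> diagram \<Lambda>"
    by (auto simp: cells_def diagram_eqs)
  have "\<exists>T. repeated_insertion \<mu> \<Lambda> S0 k0 (Suc N) T" if "insertion S0 k0 S'" for S0 k0
  proof (intro exI repeated_insertion.again[where \<nu> = \<Lambda> and c = ?c and e = ?e])
    show "dom S' = diagram \<Lambda>" "S' ?c = Some ?e"
      by (auto simp: S'_def diagram_eqs)
    have "2 + value_at S' ?c = l"
      using assms by (simp add: S'_def value_at_def)
    moreover have "part \<Lambda> l = Suc n - l"
      using assms by (intro part_\<Lambda>)
    \<comment> \<open>The bound would read \<open>n + 1 \<le> (n + 1 - l) + 1\<close>, which fails
      for \<open>l \<ge> 3\<close>.\<close>
    ultimately have "\<not> Suc n \<le> part \<Lambda> (2 + value_at S' ?c) + 2 - 1"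
      using assms by simp
    then show "\<not> (diagram \<Lambda> \<subseteq> diagram \<Lambda> \<and> S' \<in> bicolored_tableaux_within \<Lambda> \<Lambda>)"
      using c unfolding bicolored_tableaux_within_def by blast
    show "diagram \<Lambda> - diagram \<mu> = {?c}"
      using c by (auto simp: diagram_eqs)
    have "S'(?c := None) = ?S"
      using c by (auto simp: S'_def zeros_def)
    moreover have "variable_index ?c ?e = l"
      using assms by simp
    ultimately show "repeated_insertion \<mu> \<Lambda> (S'(?c := None)) (variable_index ?c ?e) N T"
      using assms by (simp only:)
  qed (use that strict_partitions covers in auto)
  moreover have "bump_chain ?S (l, n) Rightwards l S'"
    unfolding S'_def by (rule bump_chain.stop, rule bump_exit) (use assms n in auto)
  ultimately show ?thesis
    unfolding completes_def by blast
qed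

lemma completes_final:
  assumes "\<And>i. (i, i) \<notin> R"
  shows "completes (zeros (cells n) R) (2, n) Rightwards 2 1"
proof -
  \<comment> \<open>\<open>R\<close> may contain cells outside \<open>cells n\<close>, but the new
    cell is black.\<close>
  define R' where "R' = R - {(2, Suc n)}"
  have "(zeros (cells n) R)((2, Suc n) \<mapsto> (2 - 2, Black)) = zeros (diagram \<Lambda>) R'"
    by (auto simp: diagram_eqs zeros_def R'_def)
  moreover have "bump (zeros (cells n) R) (2, n) Rightwards 2
      ((zeros (cells n) R)((2, Suc n) \<mapsto> (2 - 2, Black))) (2, Suc n) None"
    using n by (intro bump_exit) auto
  ultimately have "bump_chain (zeros (cells n) R) (2, n) Rightwards 2 (zeros (diagram \<Lambda>) R')"
    by (metis bump_chain.stop)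
  moreover have "zeros (diagram \<Lambda>) R' \<in> bicolored_tableaux_within \<Lambda> \<Lambda>"
    using assms by (intro zeros_within) (auto simp: R'_def)
  then have "repeated_insertion \<mu> \<Lambda> S0 k0 1 (zeros (diagram \<Lambda>) R')"
    if "insertion S0 k0 (zeros (diagram \<Lambda>) R')" for S0 k0
    using that strict_partitions covers by (intro repeated_insertion.finish) auto
  ultimately show ?thesis
    unfolding completes_def by blast
qed

definition interior :: "(nat \<times> nat) set \<Rightarrow> bool" where
  "interior R \<longleftrightarrow> (\<forall>(i, j) \<in> R. 2 \<le> i \<and> i < j)"

lemma interiorD: "interior R \<Longrightarrow> (i, j) \<in> R \<Longrightarrow> 2 \<le> i \<and> i < j"
  by (auto simp: interior_def)

text \<open>The first of two insertions stores \<open>k\<close> as a red entry in the first row and produces the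
  index 1; inserting 1 then restores the black first row and releases \<open>k\<close> into the second row.\<close>

lemma two_insertions:
  assumes "completes (zeros (cells n) R) (1, k) Downwards k N" and "interior R" "2 \<le> k" "k \<le> n"
  shows "\<exists>T. repeated_insertion \<mu> \<Lambda> (zeros (cells n) R) k (Suc N) T"
proof -
  define R1 where "R1 = insert (1, k) R"
  have R: "(1, q) \<notin> R" "(q, q) \<notin> R" for q
    using interiorD[OF assms(2)] by fastforce+
  obtain j where k: "k = Suc j" using assms by (cases k) auto
  have "R1 - {(1, k)} = R" using R by (auto simp: R1_def)
  then have "bump (zeros (cells n) R1) (1, j) Rightwards 1
      (zeros (cells n) R) (1, k) (Some (Downwards, k))"
    using bump_right[of 1 j n R1 1] assms by (simp add: k R1_def cells_def)
  then have "completes (zeros (cells n) R1) (1, j) Rightwards 1 N"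
    using assms completes_continue by blast
  then have "completes (zeros (cells n) R1) (1, 1) Rightwards 1 N"
    by (rule completes_right) (use assms R k in \<open>auto simp: cells_def R1_def\<close>)
  moreover have "bump (zeros (cells n) R1) (0, 0) Downwards 1
      (zeros (cells n) R1) (1, 1) (Some (Rightwards, 1))"
    using bump_down[of 0 1 n R1 0] assms R by (simp add: R1_def cells_def)
  ultimately obtain T where "repeated_insertion \<mu> \<Lambda> (zeros (cells n) R1) 1 N T"
    using completes_continue completes_insertion by blast
  then have "completes (zeros (cells n) R1) (1, Suc n) Rightwards 1 (Suc N)"
    by (rule completes_exit_first)
  then have "completes (zeros (cells n) R1) (1, k) Rightwards 1 (Suc N)"
    by (rule completes_right) (use assms R in \<open>auto simp: cells_def R1_def\<close>)
  moreover have "bump (zeros (cells n) R) (0, 0) Downwards k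
      (zeros (cells n) R1) (1, k) (Some (Rightwards, 1))"
    using bump_down[of 0 k n R 0] assms R by (simp add: R1_def cells_def)
  ultimately show ?thesis
    using completes_continue completes_insertion by blast
qed

text \<open>The running insertion ends at the next end of a line, and each further end costs two
  insertions: \<open>1 + 2 * (N - 1)\<close>. Positivity of \<open>N\<close> keeps
  \<open>2 * N - 1\<close> from truncating.\<close>

lemma walk_completes:
  assumes "walk n R l p N" "interior R" "2 \<le> l" "l \<le> n"
  shows "0 < N \<and> (if p \<le> l then completes (zeros (cells n) R) (p - 1, l) Downwards l (2 * N - 1)
    else completes (zeros (cells n) R) (l, p - 1) Rightwards l (2 * N - 1))"
  using assms
proof (induction rule: walk.induct)
  case (final R)
  then show ?case
    using n completes_final[of R] by (auto dest: interiorD)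
next
  case (new_pass R l N)
  then have IH: "0 < N" "completes (zeros (cells n) R) (1, l) Downwards l (2 * N - 1)"
    by auto
  then obtain T where "repeated_insertion \<mu> \<Lambda> (zeros (cells n) R) l (Suc (2 * N - 1)) T"
    using two_insertions new_pass by blast
  then have "completes (zeros (cells n) R) (l, n) Rightwards l (Suc (Suc (2 * N - 1)))"
    using new_pass by (intro completes_exit) auto
  then show ?case
    using IH new_pass by auto
next
  case (turn R l N)
  then obtain i where i: "l = Suc i" by (cases l) auto
  have "bump (zeros (cells n) R) (i, l) Downwards l (zeros (cells n) R) (l, l)
      (Some (Rightwards, l))"
    using bump_down[of i l n R l] turn interiorD[of R l l] by (auto simp: i cells_def)
  then show ?case
    using turn completes_continue by (auto simp: i)
next
  case (down_red R l p N)
  then obtain i where i: "p = Suc i" by (cases p) auto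
  have "insert (p, l) R = R" using down_red by auto
  then have "bump (zeros (cells n) R) (i, l) Downwards l (zeros (cells n) R) (p, l)
      (Some (Downwards, l))"
    using bump_down[of i l n R l] down_red interiorD[of R p p] by (auto simp: i cells_def)
  then show ?case
    using down_red completes_continue by (auto simp: i)
next
  case (down_black p l R N)
  then obtain i where i: "p = Suc i" by (cases p) auto
  have "interior (insert (p, l) R)"
    using down_black by (auto simp: interior_def)
  moreover have "bump (zeros (cells n) R) (i, l) Downwards l
      (zeros (cells n) (insert (p, l) R)) (p, l) (Some (Rightwards, p))"
    using bump_down[of i l n R l] down_black interiorD[of R p p] by (auto simp: i cells_def)
  ultimately show ?case
    using down_black completes_continue by (auto simp: i)
next
  case (right_black R l p N)
  then obtain j where j: "p = Suc j" by (cases p) auto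
  have "R - {(l, p)} = R" using right_black by auto
  then have "bump (zeros (cells n) R) (l, j) Rightwards l (zeros (cells n) R) (l, p)
      (Some (Rightwards, l))"
    using bump_right[of l j n R l] right_black by (auto simp: j cells_def)
  then show ?case
    using right_black completes_continue by (auto simp: j)
next
  case (right_red R l p N)
  then obtain j where j: "p = Suc j" by (cases p) auto
  have "interior (R - {(l, p)})"
    using right_red by (auto simp: interior_def)
  moreover have "bump (zeros (cells n) R) (l, j) Rightwards l
      (zeros (cells n) (R - {(l, p)})) (l, p) (Some (Downwards, p))"
    using bump_right[of l j n R l] right_red by (auto simp: j cells_def)
  ultimately show ?case
    using right_red completes_continue by (auto simp: j)
qed

lemma exponential_insertions:
  defines "S \<equiv> zeros (diagram \<mu>) ({2} \<times> {3..n})"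
  shows "S \<in> bicolored_tableaux_within \<mu> \<Lambda>"
    and "\<exists>T. repeated_insertion \<mu> \<Lambda> S 2 (2 ^ (n - 1)) T"
proof -
  show "S \<in> bicolored_tableaux_within \<mu> \<Lambda>"
    unfolding S_def by (rule zeros_within) (auto simp: diagram_eqs)
  have R: "interior ({2} \<times> {3..n})" by (auto simp: interior_def)
  have "completes (zeros (cells n) ({2} \<times> {3..n})) (1, 2) Downwards 2 (2 * 2 ^ (n - 2) - 1)"
    using walk_completes[OF walk_total R] n by simp
  then have "\<exists>T. repeated_insertion \<mu> \<Lambda> S 2 (Suc (2 * 2 ^ (n - 2) - 1)) T"
    unfolding S_def diagram_eqs using n by (intro two_insertions R) auto
  \<comment> \<open>The extra \<open>Suc\<close> is the very first insertion, which parks the index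
    2 in row 1.\<close>
  moreover have "Suc (2 * 2 ^ (n - 2) - 1) = 2 ^ (n - 1)"
    using n by (simp flip: power_Suc add: Suc_diff_le)
  ultimately show "\<exists>T. repeated_insertion \<mu> \<Lambda> S 2 (2 ^ (n - 1)) T"
    by simp
qed

end

theorem theorem9:
  fixes m :: nat and \<mu> \<Lambda> :: "nat list"
  assumes "m > 0"
    and "\<mu> = (m + 2) # rev [1..<m + 1]"
    and "\<Lambda> = (m + 2) # (m + 1) # rev [1..<m]"
  shows "\<exists>S \<in> bicolored_tableaux_within \<mu> \<Lambda>. \<exists>S'. repeated_insertion \<mu> \<Lambda> S 2 (2 ^ m) S'"
proof -
  interpret staircase "m + 1" \<mu> \<Lambda>
    using assms by unfold_locales auto
  show ?thesis using exponential_insertions by auto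
qed

end
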